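(* Let $f \in \mathrm{SL}(2,\mathbb{C})$ act on $\widehat{\mathbb{C}}$ by the corresponding Möbius map. Suppose $f$ is loxodromic, i.e. conjugate to $z \mapsto \lambda z$ with $|\lambda| \neq 1$. Then for any point $x$ in the attracting basin of the attracting fixed point $p$ of $f$, the family of iterates $F = \{f^n : n \ge 0\}$ is orbitally Equi-Baire one at $x$. Moreover, an explicit $\delta$-function witnessing this property is given by $$S(x,r) = \sup_{n \ge 0}\ \sup_{y \in B_r(x)} d(f^n(y), f^n(x)),$$ and $S(x,r) \to 0$ as $r \to 0$.
   Context: $\widehat{\mathbb{C}} = \mathbb{C}\cup\{\infty\}$ is the Riemann sphere. A matrix $\begin{pmatrix} a&b\\c&d\end{pmatrix}\in \mathrm{SL}(2,\mathbb{C})$ acts on $\widehat{\mathbb{C}}$ by $z\mapsto \frac{az+b}{cz+d}$ (with the usual conventions at $\infty$). Conjugacy is in $\mathrm{PSL}(2,\mathbb{C})$. $f^n$ is the $n$-th iterate, $f^0=\mathrm{id}$. $d$ is the chordal metric: $d(z_1,z_2)=\frac{|z_1-z_2|}{\sqrt{(1+|z_1|^2)(1+|z_2|^2)}}$ for $z_1,z_2\in\mathbb{C}$, and $d(z,\infty)=(1+|z|^2)^{-1/2}$. $B_r(x)$ is the open $d$-ball of radius $r>0$ about $x$. A fixed point $p$ of $f$ is attracting if $|f'(p)|<1$ (computed in a local coordinate if $p=\infty$); a loxodromic map has exactly two fixed points, one attracting and one repelling. The attracting basin of $p$ is $\mathcal{A}(p)=\{x\in\widehat{\mathbb{C}} :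 f^n(x)\to p \text{ as } n\to\infty\}$. The family $\{f^n : n\ge 0\}$ is orbitally Equi-Baire one at $x$ if for every $\varepsilon>0$ there exists $\delta>0$ (depending on $x$) such that for all $y\in\widehat{\mathbb{C}}$ with $d(y,x)<\delta$ one has $d(f^n(y),f^n(x))<\varepsilon$ for all $n\ge 0$. That $S(x,\cdot)$ witnesses this property means that any $\delta>0$ with $S(x,\delta)<\varepsilon$ serves for $\varepsilon$. *)

theory Defs
  imports "HOL-Analysis.Analysis"
begin

datatype riemann_sphere = Fin complex | Infty

fun chordal :: "riemann_sphere \<Rightarrow> riemann_sphere \<Rightarrow> real" where
  "chordal (Fin z) (Fin w) = norm (z - w) / sqrt ((1 + (norm z)\<^sup>2) * (1 + (norm w)\<^sup>2))"
| "chordal (Fin z) Infty = 1 / sqrt (1 + (norm z)\<^sup>2)"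
| "chordal Infty (Fin z) = 1 / sqrt (1 + (norm z)\<^sup>2)"
| "chordal Infty Infty = 0"

text \<open>Stereographic projection onto the sphere of diameter 1 in \<open>\<complex> \<times> \<real>\<close>, with \<open>Infty\<close> sent
  to the origin. It carries \<open>chordal\<close> to the Euclidean distance, whence the metric axioms.\<close>

fun stereo :: "riemann_sphere \<Rightarrow> complex \<times> real" where
  "stereo (Fin z) = (z / of_real (1 + (norm z)\<^sup>2), 1 / (1 + (norm z)\<^sup>2))"
| "stereo Infty = (0, 0)"

lemma one_plus_norm_sq_pos: "0 < 1 + (norm (z :: complex))\<^sup>2"
  by (simp add: add_pos_nonneg)

lemma norm_stereo_Fin: "norm (stereo (Fin z)) = 1 / sqrt (1 + (norm z)\<^sup>2)"
proof -
  define s where "s = 1 + (norm z)\<^sup>2"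
  have s: "s > 0" unfolding s_def by (rule one_plus_norm_sq_pos)
  have "(norm (z / of_real s))\<^sup>2 + (norm (1 / s))\<^sup>2 = ((norm z)\<^sup>2 + 1) / s\<^sup>2"
    by (simp add: norm_divide power_divide add_divide_distrib)
  also have "\<dots> = 1 / s"
    using s by (simp add: s_def power2_eq_square add.commute)
  finally show ?thesis
    by (simp only: stereo.simps norm_Pair real_sqrt_divide real_sqrt_one flip: s_def)
qed

lemma norm_stereo_diff:
  "norm (stereo (Fin z) - stereo (Fin w))
    = norm (z - w) / sqrt ((1 + (norm z)\<^sup>2) * (1 + (norm w)\<^sup>2))"
proof -
  define s t where "s = 1 + (norm z)\<^sup>2" and "t = 1 + (norm w)\<^sup>2"
  have st: "s > 0" "t > 0" unfolding s_def t_def by (rule one_plus_norm_sq_pos)+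
  have ip: "stereo (Fin z) \<bullet> stereo (Fin w) = (z \<bullet> w + 1) / (s * t)"
  proof -
    have e: "u / of_real r = (1 / r) *\<^sub>R u" for u :: complex and r :: real
      by (simp add: scaleR_conv_of_real)
    show ?thesis
      by (simp only: stereo.simps inner_Pair e inner_scaleR_left inner_scaleR_right
          flip: s_def t_def) (simp add: add_divide_distrib)
  qed
  have sq: "(norm (stereo (Fin z)))\<^sup>2 = 1 / s" "(norm (stereo (Fin w)))\<^sup>2 = 1 / t"
    using st by (simp_all only: norm_stereo_Fin power_divide real_sqrt_pow2 less_imp_le one_power2 flip: s_def t_def)
  have "(norm (stereo (Fin z) - stereo (Fin w)))\<^sup>2 = 1 / s + 1 / t - 2 * ((z \<bullet> w + 1) / (s * t))"
    by (simp only: power2_norm_eq_inner inner_diff inner_commute[of "stereo (Fin w)" "stereo (Fin z)"] ip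
        sq[unfolded power2_norm_eq_inner])
  also have "\<dots> = (s + t - 2 * (z \<bullet> w) - 2) / (s * t)"
    using st by (simp add: field_simps)
  also have "s + t - 2 * (z \<bullet> w) - 2 = (norm (z - w))\<^sup>2"
    by (simp add: s_def t_def power2_norm_eq_inner inner_diff inner_commute)
  finally have "norm (stereo (Fin z) - stereo (Fin w)) = sqrt ((norm (z - w))\<^sup>2 / (s * t))"
    by (metis norm_ge_zero real_sqrt_unique)
  then show ?thesis by (simp add: real_sqrt_divide flip: s_def t_def)
qed

lemma stereo_Infty: "stereo Infty = 0"
  by (simp add: zero_prod_def)

lemma chordal_eq_dist: "chordal x y = dist (stereo x) (stereo y)"
proof (cases x; cases y)
  fix z w assume "x = Fin z" "y = Fin w"
  then show ?thesis by (simp only: chordal.simps dist_norm norm_stereo_diff)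
next
  fix z assume "x = Fin z" "y = Infty"
  then show ?thesis
    by (simp add: stereo_Infty norm_stereo_Fin del: stereo.simps)
next
  fix w assume "x = Infty" "y = Fin w"
  then show ?thesis
    by (simp add: stereo_Infty norm_stereo_Fin del: stereo.simps)
qed simp

lemma chordal_eq_0_iff: "chordal x y = 0 \<longleftrightarrow> x = y"
proof -
  have "1 + (norm (z :: complex))\<^sup>2 \<noteq> 0" for z using one_plus_norm_sq_pos[of z] by linarith
  then show ?thesis by (cases x; cases y) auto
qed

instantiation riemann_sphere :: metric_space
begin

definition dist_riemann_sphere :: "riemann_sphere \<Rightarrow> riemann_sphere \<Rightarrow> real" where
  "dist_riemann_sphere = chordal"

definition uniformity_riemann_sphere :: "(riemann_sphere \<times> riemann_sphere) filter" where
  "uniformity_riemann_sphere = (INF e\<in>{0 <..}. principal {(x, y). dist x y < e})"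

definition open_riemann_sphere :: "riemann_sphere set \<Rightarrow> bool" where
  "open_riemann_sphere U \<longleftrightarrow> (\<forall>x\<in>U. eventually (\<lambda>(x', y). x' = x \<longrightarrow> y \<in> U) uniformity)"

instance
proof
  fix x y z :: riemann_sphere
  show "dist x y = 0 \<longleftrightarrow> x = y"
    by (simp add: dist_riemann_sphere_def chordal_eq_0_iff)
  show "dist x y \<le> dist x z + dist y z"
    by (simp add: dist_riemann_sphere_def chordal_eq_dist dist_triangle2)
qed (simp_all add: uniformity_riemann_sphere_def open_riemann_sphere_def)

end

lemma dist_riemann_sphere_le_1: "dist x y \<le> 1" for x y :: riemann_sphere
proof -
  have "(norm (z - w))\<^sup>2 \<le> (1 + (norm z)\<^sup>2) * (1 + (norm w)\<^sup>2)" for z w :: complex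
  proof -
    have "(norm (z - w))\<^sup>2 \<le> (norm z + norm w)\<^sup>2"
      by (simp add: norm_triangle_ineq4 power_mono)
    also have "\<dots> = (1 + (norm z)\<^sup>2) * (1 + (norm w)\<^sup>2) - (1 - norm z * norm w)\<^sup>2"
      by (simp add: power2_eq_square algebra_simps)
    finally show ?thesis by (smt (verit) zero_le_power2)
  qed
  then have "norm (z - w) \<le> sqrt ((1 + (norm z)\<^sup>2) * (1 + (norm w)\<^sup>2))" for z w :: complex
    by (rule real_le_rsqrt)
  then show ?thesis
    by (cases x; cases y)
      (auto simp: dist_riemann_sphere_def divide_le_eq_1 one_plus_norm_sq_pos not_less
        mult_pos_pos)
qed

definition SL2 :: "(complex^2^2) set" where
  "SL2 = {A. det A = 1}"

fun moebius_map :: "complex^2^2 \<Rightarrow> riemann_sphere \<Rightarrow> riemann_sphere" where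
  "moebius_map A (Fin z) =
    (if A$2$1 * z + A$2$2 = 0 then Infty else Fin ((A$1$1 * z + A$1$2) / (A$2$1 * z + A$2$2)))"
| "moebius_map A Infty = (if A$2$1 = 0 then Infty else Fin (A$1$1 / A$2$1))"

fun dilation :: "complex \<Rightarrow> riemann_sphere \<Rightarrow> riemann_sphere" where
  "dilation c (Fin z) = Fin (c * z)"
| "dilation c Infty = Infty"

definition loxodromic :: "complex^2^2 \<Rightarrow> bool" where
  "loxodromic A \<longleftrightarrow>
    (\<exists>H\<in>SL2. \<exists>c. c \<noteq> 0 \<and> norm c \<noteq> 1 \<and> moebius_map (H ** A ** matrix_inv H) = dilation c)"

fun sphere_inverse :: "riemann_sphere \<Rightarrow> riemann_sphere" where
  "sphere_inverse (Fin z) = (if z = 0 then Infty else Fin (inverse z))"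
| "sphere_inverse Infty = Fin 0"

text \<open>The value at \<open>Infty\<close> is arbitrary: \<open>fin_part\<close> is only used to differentiate a map near a
  finite fixed point.\<close>

fun fin_part :: "riemann_sphere \<Rightarrow> complex" where
  "fin_part (Fin z) = z"
| "fin_part Infty = 0"

text \<open>At \<open>Infty\<close> the derivative is taken in the local coordinate \<open>w = 1 / z\<close>.\<close>

fun has_multiplier :: "(riemann_sphere \<Rightarrow> riemann_sphere) \<Rightarrow> complex \<Rightarrow> riemann_sphere \<Rightarrow> bool" where
  "has_multiplier f m (Fin z) \<longleftrightarrow> ((\<lambda>w. fin_part (f (Fin w))) has_field_derivative m) (at z)"
| "has_multiplier f m Infty \<longleftrightarrow>
    ((\<lambda>w. fin_part (sphere_inverse (f (sphere_inverse (Fin w))))) has_field_derivative m) (at 0)"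

definition attracting_fixed_point :: "(riemann_sphere \<Rightarrow> riemann_sphere) \<Rightarrow> riemann_sphere \<Rightarrow> bool" where
  "attracting_fixed_point f p \<longleftrightarrow> f p = p \<and> (\<exists>m. has_multiplier f m p \<and> norm m < 1)"

definition attracting_basin :: "('a::topological_space \<Rightarrow> 'a) \<Rightarrow> 'a \<Rightarrow> 'a set" where
  "attracting_basin f p = {x. (\<lambda>n. (f ^^ n) x) \<longlonglongrightarrow> p}"

definition orbital_delta :: "('a::metric_space \<Rightarrow> 'a) \<Rightarrow> 'a \<Rightarrow> real \<Rightarrow> real \<Rightarrow> bool" where
  "orbital_delta f x \<epsilon> \<delta> \<longleftrightarrow>
    (\<forall>y. dist y x < \<delta> \<longrightarrow> (\<forall>n. dist ((f ^^ n) y) ((f ^^ n) x) < \<epsilon>))"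

definition orbitally_equi_baire_one_at :: "('a::metric_space \<Rightarrow> 'a) \<Rightarrow> 'a \<Rightarrow> bool" where
  "orbitally_equi_baire_one_at f x \<longleftrightarrow> (\<forall>\<epsilon>>0. \<exists>\<delta>>0. orbital_delta f x \<epsilon> \<delta>)"

text \<open>A function \<open>S\<close> of the radius witnesses the property at \<open>x\<close> if every \<open>\<delta> > 0\<close> with
  \<open>S \<delta> < \<epsilon>\<close> serves for \<open>\<epsilon>\<close>.\<close>

definition witnesses_equi_baire_one_at :: "(real \<Rightarrow> real) \<Rightarrow> ('a::metric_space \<Rightarrow> 'a) \<Rightarrow> 'a \<Rightarrow> bool" where
  "witnesses_equi_baire_one_at S f x \<longleftrightarrow> (\<forall>\<epsilon>>0. \<forall>\<delta>>0. S \<delta> < \<epsilon> \<longrightarrow> orbital_delta f x \<epsilon> \<delta>)"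

text \<open>The suprema are real-valued; for \<open>r > 0\<close> they range over nonempty sets
  bounded by \<open>dist_riemann_sphere_le_1\<close>, so no default values of \<open>Sup\<close> enter.\<close>

definition orbital_modulus ::
  "(riemann_sphere \<Rightarrow> riemann_sphere) \<Rightarrow> riemann_sphere \<Rightarrow> real \<Rightarrow> real" where
  "orbital_modulus f x r = (SUP n. SUP y\<in>ball x r. dist ((f ^^ n) y) ((f ^^ n) x))"

end

theory Submission
  imports Defs
begin

text \<open>The attracting fixed point \<open>p\<close> is Lyapunov stable: since the multiplier has norm below 1, the
  map does not increase the Euclidean distance to \<open>p\<close> in a small disc of a local coordinate
  (\<open>stable_at_attracting_fixed_point\<close>), so that orbits starting near \<open>p\<close> stay near \<open>p\<close> for all time.

  Equicontinuity of the iterates then spreads from \<open>p\<close> over its whole basin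
  (\<open>orbitally_equi_baire_one_at_basin\<close>): an orbit of the basin enters the stable neighbourhood of \<open>p\<close>
  at some time \<open>N\<close>, and so do, at the same time \<open>N\<close>, the orbits of all points near \<open>x\<close>. From then on
  all these orbits are close to \<open>p\<close>, hence to each other; the finitely many earlier iterates are
  taken care of by their continuity. Continuity holds because a Moebius map is
  Lipschitz for the chordal metric (\<open>lipschitz_moebius_map\<close>).

  Finally, \<open>orbital_modulus\<close> is the least modulus of continuity valid for all iterates at once.
  A bound on it is therefore a bound for every iterate, and its convergence to 0
  is a reformulation of equicontinuity.\<close>


section \<open>Equicontinuity on the basin of a stable fixed point\<close>

definition stable_at :: "('a::metric_space \<Rightarrow> 'a) \<Rightarrow> 'a \<Rightarrow> bool" where
  "stable_at f p \<longleftrightarrow> (\<forall>e>0. \<exists>d>0. \<forall>y. dist y p < d \<longrightarrow> (\<forall>n. dist ((f ^^ n) y) p < e))"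

lemma continuous_funpow:
  fixes f :: "'a::topological_space \<Rightarrow> 'a"
  assumes "continuous_on UNIV f"
  shows "continuous_on UNIV (f ^^ n)"
  using assms by (induction n) (auto simp: id_def intro: continuous_on_compose2)

lemma orbitally_equi_baire_one_at_basin:
  fixes f :: "'a::metric_space \<Rightarrow> 'a"
  assumes cont: "continuous_on UNIV f"
    and stable: "stable_at f p"
    and basin: "x \<in> attracting_basin f p"
  shows "orbitally_equi_baire_one_at f x"
  unfolding orbitally_equi_baire_one_at_def orbital_delta_def
proof (intro allI impI)
  fix e :: real
  assume e: "e > 0"
  then obtain d where "d > 0"
    and d: "\<And>y n. dist y p < d \<Longrightarrow> dist ((f ^^ n) y) p < e / 2"
    using stable unfolding stable_at_def by (meson half_gt_zero)
  obtain N where N: "dist ((f ^^ N) x) p < d"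
    using basin \<open>d > 0\<close> unfolding attracting_basin_def lim_sequentially by blast
  have iterate: "\<forall>\<^sub>F y in nhds x. dist ((f ^^ n) y) ((f ^^ n) x) < r" if "r > 0" for n r
    using continuous_funpow[OF cont, of n] that
    by (metis UNIV_I continuous_on_def tendstoD tendsto_at_iff_tendsto_nhds)
  have "\<forall>\<^sub>F y in nhds x. (\<forall>n\<in>{..<N}. dist ((f ^^ n) y) ((f ^^ n) x) < e)
      \<and> dist ((f ^^ N) y) ((f ^^ N) x) < d - dist ((f ^^ N) x) p"
    using e N by (intro eventually_conj eventually_ball_finite ballI iterate) auto
  then obtain \<delta> where "\<delta> > 0"
    and early: "\<And>y n. dist y x < \<delta> \<Longrightarrow> n < N \<Longrightarrow> dist ((f ^^ n) y) ((f ^^ n) x) < e"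
    and entry: "\<And>y. dist y x < \<delta> \<Longrightarrow> dist ((f ^^ N) y) ((f ^^ N) x) < d - dist ((f ^^ N) x) p"
    unfolding eventually_nhds_metric by auto
  have "dist ((f ^^ n) y) ((f ^^ n) x) < e" if y: "dist y x < \<delta>" for y n
  proof (cases "n < N")
    case True
    then show ?thesis using early y by blast
  next
    case False
    then have split: "(f ^^ n) w = (f ^^ (n - N)) ((f ^^ N) w)" for w
      by (metis comp_apply funpow_add le_add_diff_inverse2 not_less)
    have "dist ((f ^^ N) y) p < d"
      using entry[OF y] dist_triangle[of "(f ^^ N) y" p "(f ^^ N) x"] by linarith
    then have "dist ((f ^^ n) y) p < e / 2" "dist ((f ^^ n) x) p < e / 2"
      unfolding split using d N by blast+
    then show ?thesis by (rule dist_triangle_half_l)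
  qed
  with \<open>\<delta> > 0\<close> show "\<exists>\<delta>>0. \<forall>y. dist y x < \<delta> \<longrightarrow> (\<forall>n. dist ((f ^^ n) y) ((f ^^ n) x) < e)"
    by blast
qed


section \<open>The sphere as the complex projective line\<close>

text \<open>Homogeneous coordinates make Moebius maps linear and remove the case distinctions at
  \<open>Infty\<close>: the chordal distance becomes the sine of the angle between two complex lines. The
  value at \<open>(0, 0)\<close> carries no meaning.\<close>

definition sphere_point :: "complex \<times> complex \<Rightarrow> riemann_sphere" where
  "sphere_point u = (if snd u = 0 then Infty else Fin (fst u / snd u))"

lemma sphere_point_surj: obtains u where "u \<noteq> 0" "x = sphere_point u"
proof (cases x)
  case (Fin z)
  show ?thesis by (rule that[of "(z, 1)"]) (auto simp: Fin sphere_point_def zero_prod_def)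
next
  case Infty
  show ?thesis by (rule that[of "(1, 0)"]) (auto simp: Infty sphere_point_def zero_prod_def)
qed

lemma dist_sphere_point:
  assumes "u \<noteq> 0" "v \<noteq> 0"
  shows "dist (sphere_point u) (sphere_point v)
    = norm (fst u * snd v - snd u * fst v) / (norm u * norm v)"
proof -
  obtain a b c d where uv: "u = (a, b)" "v = (c, d)" by fastforce
  have root: "sqrt (1 + (norm (s / t))\<^sup>2) = norm (s, t) / norm t" if "t \<noteq> 0" for s t :: complex
  proof -
    have "1 + (norm (s / t))\<^sup>2 = ((norm s)\<^sup>2 + (norm t)\<^sup>2) / (norm t)\<^sup>2"
      using that by (simp add: norm_divide field_simps)
    then show ?thesis by (simp add: norm_Pair real_sqrt_divide)
  qed
  have quot: "norm (a / b - c / d) = norm (a * d - b * c) / (norm b * norm d)"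
    if "b \<noteq> 0" "d \<noteq> 0"
    using that by (simp add: diff_frac_eq mult.commute flip: norm_mult norm_divide)
  show ?thesis
  proof (cases "b = 0"; cases "d = 0")
    assume "b \<noteq> 0" "d \<noteq> 0"
    then show ?thesis
      by (simp add: uv sphere_point_def dist_riemann_sphere_def real_sqrt_mult root quot)
  next
    assume "b = 0" "d \<noteq> 0"
    then show ?thesis using assms
      by (simp add: uv sphere_point_def dist_riemann_sphere_def root norm_mult zero_prod_def)
  next
    assume "b \<noteq> 0" "d = 0"
    then show ?thesis using assms
      by (simp add: uv sphere_point_def dist_riemann_sphere_def root norm_mult zero_prod_def)
  qed (simp add: uv sphere_point_def)
qed

lemma moebius_map_sphere_point:
  assumes "det A \<noteq> 0" "u \<noteq> 0"
  shows "moebius_map A (sphere_point u)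
    = sphere_point (A$1$1 * fst u + A$1$2 * snd u, A$2$1 * fst u + A$2$2 * snd u)"
proof (cases "snd u = 0")
  case True
  then show ?thesis using assms(2) by (simp add: sphere_point_def prod_eq_iff)
next
  case False
  then have "A$i$1 * (fst u / snd u) + A$i$2 = (A$i$1 * fst u + A$i$2 * snd u) / snd u" for i
    by (simp add: field_simps)
  then show ?thesis using False by (simp add: sphere_point_def)
qed

text \<open>The numerator of the chordal distance in homogeneous coordinates is multiplied by \<open>det A = 1\<close>
  under the linear map \<open>A\<close>, and the denominator shrinks by a bounded factor only, because the inverse
  of \<open>A\<close> (which is its adjugate) is bounded.\<close>

lemma lipschitz_moebius_map:
  assumes "A \<in> SL2"
  obtains L where "\<And>x y. dist (moebius_map A x) (moebius_map A y) \<le> L * dist x y"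
proof -
  define a b c d where "a = A$1$1" and "b = A$1$2" and "c = A$2$1" and "d = A$2$2"
  have det: "a * d - b * c = 1"
    using assms by (simp add: SL2_def det_2 a_def b_def c_def d_def)
  define T :: "complex \<times> complex \<Rightarrow> complex \<times> complex"
    where "T u = (a * fst u + b * snd u, c * fst u + d * snd u)" for u
  define M where "M = norm a + norm b + norm c + norm d"
  have bound: "norm u \<le> M * norm (T u)" for u
  proof -
    have inv: "fst u = d * fst (T u) - b * snd (T u)" "snd u = a * snd (T u) - c * fst (T u)"
      using det by (simp_all add: T_def) algebra+
    have parts: "norm (fst (T u)) \<le> norm (T u)" "norm (snd (T u)) \<le> norm (T u)"
      by (metis norm_fst_le norm_snd_le prod.collapse)+
    have "norm u \<le> norm (fst u) + norm (snd u)"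
      by (metis norm_Pair_le prod.collapse)
    also have "\<dots> \<le> (norm d * norm (fst (T u)) + norm b * norm (snd (T u)))
        + (norm a * norm (snd (T u)) + norm c * norm (fst (T u)))"
      unfolding norm_mult[symmetric]
      by (subst inv(1), subst inv(2)) (intro add_mono norm_triangle_ineq4)
    also have "\<dots> \<le> (norm d * norm (T u) + norm b * norm (T u))
        + (norm a * norm (T u) + norm c * norm (T u))"
      by (intro add_mono mult_left_mono parts norm_ge_zero)
    finally show ?thesis by (simp add: M_def algebra_simps)
  qed
  have "dist (moebius_map A x) (moebius_map A y) \<le> M\<^sup>2 * dist x y" for x y
  proof -
    obtain u v where u: "u \<noteq> 0" "x = sphere_point u" and v: "v \<noteq> 0" "y = sphere_point v"
      by (metis sphere_point_surj)
    have T: "T u \<noteq> 0" "T v \<noteq> 0"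
      using bound[of u] bound[of v] u(1) v(1) by auto
    define k where "k = norm (fst u * snd v - snd u * fst v)"
    have wedge: "fst (T u) * snd (T v) - snd (T u) * fst (T v) = fst u * snd v - snd u * fst v"
      using det by (simp add: T_def) algebra
    have image: "moebius_map A (sphere_point w) = sphere_point (T w)" if "w \<noteq> 0" for w
      using that assms by (simp add: moebius_map_sphere_point SL2_def T_def a_def b_def c_def d_def)
    have M: "M > 0"
      using bound[of u] u(1) by (smt (verit) mult_nonpos_nonneg norm_ge_zero zero_less_norm_iff)
    have "dist (moebius_map A x) (moebius_map A y) = k / (norm (T u) * norm (T v))"
      using u v T by (simp add: image dist_sphere_point wedge k_def)
    also have "\<dots> = M\<^sup>2 * (k / ((M * norm (T u)) * (M * norm (T v))))"
      using M by (simp add: power2_eq_square)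
    also have "\<dots> \<le> M\<^sup>2 * (k / (norm u * norm v))"
      using u(1) v(1) M T
      by (intro mult_left_mono divide_left_mono mult_mono mult_pos_pos bound) (simp_all add: k_def)
    also have "k / (norm u * norm v) = dist x y"
      using u v by (simp add: dist_sphere_point k_def)
    finally show ?thesis .
  qed
  then show thesis by (rule that)
qed

lemma continuous_moebius_map:
  assumes "A \<in> SL2"
  shows "continuous_on UNIV (moebius_map A)"
proof -
  obtain L where L: "\<And>x y. dist (moebius_map A x) (moebius_map A y) \<le> L * dist x y"
    using lipschitz_moebius_map[OF assms] by blast
  then have "dist (moebius_map A x) (moebius_map A y) \<le> \<bar>L\<bar> * dist x y" for x y
    by (meson abs_ge_self mult_right_mono order_trans zero_le_dist)
  then have "\<bar>L\<bar>-lipschitz_on UNIV (moebius_map A)"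
    by (auto intro: lipschitz_onI)
  then show ?thesis by (rule lipschitz_on_continuous_on)
qed

lemma dist_sphere_inverse: "dist (sphere_inverse x) (sphere_inverse y) = dist x y"
proof -
  have inv: "sphere_inverse (sphere_point u) = sphere_point (snd u, fst u)" if "u \<noteq> 0" for u
    using that by (auto simp: sphere_point_def prod_eq_iff)
  obtain u v where u: "u \<noteq> 0" "x = sphere_point u" and v: "v \<noteq> 0" "y = sphere_point v"
    by (metis sphere_point_surj)
  have swap: "(snd w, fst w) \<noteq> 0" "norm (snd w, fst w) = norm w" if "w \<noteq> 0"
    for w :: "complex \<times> complex"
    using that by (auto simp: norm_prod_def prod_eq_iff add.commute)
  show ?thesis
    using u v swap by (simp add: inv dist_sphere_point norm_minus_commute)
qed

lemma sphere_inverse_sphere_inverse [simp]: "sphere_inverse (sphere_inverse x) = x"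
  by (cases x) auto


section \<open>Attracting fixed points are stable\<close>

lemma dist_Fin_le: "dist (Fin w) (Fin z) \<le> norm (w - z)"
proof -
  have "1 \<le> sqrt ((1 + (norm w)\<^sup>2) * (1 + (norm z)\<^sup>2))"
    by (simp add: mult_ge1_I)
  then have "norm (w - z) / sqrt ((1 + (norm w)\<^sup>2) * (1 + (norm z)\<^sup>2)) \<le> norm (w - z) / 1"
    by (intro divide_left_mono) auto
  then show ?thesis by (simp add: dist_riemann_sphere_def)
qed

lemma continuous_Fin: "continuous_on UNIV Fin"
  by (rule lipschitz_on_continuous_on[where L = 1])
    (auto intro!: lipschitz_onI simp: dist_Fin_le dist_complex_def)

text \<open>With \<open>s = norm (z, 1)\<close> and \<open>t = norm (w - z)\<close>, the triangle inequality gives \<open>norm (w, 1) \<le> s + t\<close>, so the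
  chordal distance of \<open>w\<close> and \<open>z\<close> is at least \<open>t / ((s + t) * s)\<close>, which increases with \<open>t\<close>. Its
  value at \<open>t = e\<close> is thus a radius that works; it is below \<open>1 / s\<close>, the distance to \<open>Infty\<close>.\<close>

lemma chordal_ball_in_disc:
  assumes "e > 0"
  obtains d where "d > 0" "\<And>y. dist y (Fin z) < d \<Longrightarrow> \<exists>w. y = Fin w \<and> norm (w - z) < e"
proof -
  define s where "s = norm (z, 1 :: complex)"
  have s: "s > 0" "s = sqrt (1 + (norm z)\<^sup>2)"
    by (simp_all add: s_def norm_Pair add.commute one_plus_norm_sq_pos)
  define d where "d = e / ((s + e) * s)"
  have "d > 0" using assms s(1) by (simp add: d_def)
  moreover have "\<exists>w. y = Fin w \<and> norm (w - z) < e" if y: "dist y (Fin z) < d" for y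
  proof (cases y)
    case Infty
    have "e / (s + e) / s < 1 / s"
      using assms s(1) by (intro divide_strict_right_mono) simp_all
    then have "d < 1 / s" by (simp add: d_def)
    with y Infty s(2) show ?thesis by (simp add: dist_riemann_sphere_def)
  next
    case (Fin w)
    define t where "t = norm (w - z)"
    have "norm (w, 1 :: complex) = norm ((z, 1 :: complex) + (w - z, 0 :: complex))" by simp
    also have "\<dots> \<le> s + t"
      using norm_triangle_ineq[of "(z, 1 :: complex)" "(w - z, 0 :: complex)"]
      by (simp add: s_def t_def norm_Pair)
    finally have w: "sqrt (1 + (norm w)\<^sup>2) \<le> s + t" by (simp add: norm_Pair add.commute)
    have "t / ((s + t) * s) \<le> t / (sqrt (1 + (norm w)\<^sup>2) * s)"
      using w s(1) by (intro divide_left_mono mult_right_mono mult_pos_pos)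
        (auto simp: t_def one_plus_norm_sq_pos intro: add_pos_nonneg)
    also have "\<dots> = dist y (Fin z)"
      by (simp add: Fin dist_riemann_sphere_def t_def s(2) real_sqrt_mult)
    finally have "t / ((s + t) * s) < e / ((s + e) * s)" using y d_def by linarith
    moreover have "(s + t) * s > 0" "(s + e) * s > 0"
      using assms s(1) by (simp_all add: t_def add_pos_nonneg)
    ultimately have "t * ((s + e) * s) < e * ((s + t) * s)"
      by (simp only: pos_divide_less_eq pos_less_divide_eq times_divide_eq_left)
    then have "(s * s) * t < (s * s) * e" by (simp add: algebra_simps)
    then have "t < e" using s(1) by simp
    then show ?thesis by (simp add: Fin t_def)
  qed
  ultimately show thesis by (rule that)
qed

text \<open>Near the fixed point the difference quotient has norm below 1, so the distance to the fixed point does not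
  increase along an orbit. Continuity keeps the images finite, so that \<open>fin_part\<close> is the map itself.\<close>

lemma stable_at_Fin:
  assumes cont: "continuous_on UNIV f"
    and fixed: "f (Fin z) = Fin z"
    and mult: "has_multiplier f m (Fin z)"
    and m: "norm m < 1"
  shows "stable_at f (Fin z)"
proof -
  define g where "g w = fin_part (f (Fin w))" for w
  have "((\<lambda>w. (g w - g z) / (w - z)) \<longlongrightarrow> m) (at z)"
    using mult by (simp add: g_def has_field_derivative_iff)
  then have "\<forall>\<^sub>F w in at z. norm ((g w - g z) / (w - z)) < 1"
    using m by (intro order_tendstoD(2)[OF tendsto_norm])
  moreover have "\<forall>\<^sub>F w in at z. f (Fin w) \<noteq> Infty"
  proof -
    have "continuous_on UNIV (\<lambda>w. f (Fin w))"
      using continuous_on_compose[OF continuous_Fin, of f] continuous_on_subset[OF cont]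
      by (simp add: comp_def)
    then have "((\<lambda>w. f (Fin w)) \<longlongrightarrow> f (Fin z)) (at z)"
      by (simp add: continuous_on_def)
    then show ?thesis by (rule tendsto_imp_eventually_ne) (simp add: fixed)
  qed
  ultimately have "\<forall>\<^sub>F w in at z. norm ((g w - g z) / (w - z)) < 1 \<and> f (Fin w) \<noteq> Infty"
    by (rule eventually_conj)
  then obtain r where "r > 0" and r: "\<And>w. w \<noteq> z \<Longrightarrow> dist w z < r \<Longrightarrow>
      norm ((g w - g z) / (w - z)) < 1 \<and> f (Fin w) \<noteq> Infty"
    unfolding eventually_at by blast
  have step: "\<exists>w'. f (Fin w) = Fin w' \<and> norm (w' - z) \<le> norm (w - z)" if "norm (w - z) < r" for w
  proof (cases "w = z")
    case True
    then show ?thesis using fixed by auto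
  next
    case False
    with r[of w] that obtain w' where w': "f (Fin w) = Fin w'"
      and "norm ((g w - g z) / (w - z)) < 1"
      by (metis dist_norm riemann_sphere.exhaust)
    then show ?thesis
      using False by (simp add: g_def fixed norm_divide divide_less_eq_1)
  qed
  have orbit: "\<exists>w'. (f ^^ n) (Fin w) = Fin w' \<and> norm (w' - z) \<le> norm (w - z)"
    if "norm (w - z) < r" for w n
  proof (induction n)
    case (Suc n)
    then obtain w' where w': "(f ^^ n) (Fin w) = Fin w'" "norm (w' - z) \<le> norm (w - z)" by blast
    with that step[of w'] show ?case by fastforce
  qed simp
  show ?thesis
    unfolding stable_at_def
  proof (intro allI impI)
    fix e :: real
    assume "e > 0"
    with \<open>r > 0\<close> obtain d where "d > 0"
      and d: "\<And>y. dist y (Fin z) < d \<Longrightarrow> \<exists>w. y = Fin w \<and> norm (w - z) < min e r"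
      using chordal_ball_in_disc[of "min e r" z] by auto
    have "dist ((f ^^ n) y) (Fin z) < e" if y: "dist y (Fin z) < d" for y n
    proof -
      obtain w where w: "y = Fin w" "norm (w - z) < min e r" using d[OF y] by blast
      then obtain w' where "(f ^^ n) y = Fin w'" "norm (w' - z) \<le> norm (w - z)"
        using orbit[of w n] by auto
      with w(2) dist_Fin_le[of w' z] show ?thesis by simp
    qed
    with \<open>d > 0\<close> show "\<exists>d>0. \<forall>y. dist y (Fin z) < d \<longrightarrow> (\<forall>n. dist ((f ^^ n) y) (Fin z) < e)"
      by blast
  qed
qed

text \<open>At \<open>Infty\<close>, the inversion is an isometry that carries the fixed point to 0 and turns the multiplier at
  \<open>Infty\<close> into the one at 0.\<close>

lemma stable_at_attracting_fixed_point:
  assumes cont: "continuous_on UNIV f"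
    and attr: "attracting_fixed_point f p"
  shows "stable_at f p"
proof (cases p)
  case (Fin z)
  then show ?thesis
    using assms stable_at_Fin unfolding attracting_fixed_point_def by blast
next
  case Infty
  define h where "h = (\<lambda>x. sphere_inverse (f (sphere_inverse x)))"
  have inv: "continuous_on UNIV sphere_inverse"
    by (rule lipschitz_on_continuous_on[where L = 1])
      (auto intro!: lipschitz_onI simp: dist_sphere_inverse)
  have "continuous_on UNIV h"
    unfolding h_def
    by (rule continuous_on_compose2[OF inv continuous_on_compose2[OF cont inv]]) simp_all
  moreover obtain m where fixed: "f Infty = Infty" and "has_multiplier f m Infty" "norm m < 1"
    using attr Infty unfolding attracting_fixed_point_def by blast
  ultimately have "stable_at h (Fin 0)"
    by (intro stable_at_Fin[where m = m]) (simp_all add: h_def)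
  moreover have "(h ^^ n) (sphere_inverse y) = sphere_inverse ((f ^^ n) y)" for n y
    by (induction n) (simp_all add: h_def)
  moreover have "dist (sphere_inverse y) (Fin 0) = dist y Infty" for y
    using dist_sphere_inverse[of y Infty] by simp
  ultimately show ?thesis
    unfolding Infty stable_at_def by metis
qed


section \<open>The orbital modulus\<close>

lemma dist_le_orbital_modulus:
  assumes "dist y x < r"
  shows "dist ((f ^^ n) y) ((f ^^ n) x) \<le> orbital_modulus f x r"
proof -
  define s where "s n = (SUP y\<in>ball x r. dist ((f ^^ n) y) ((f ^^ n) x))" for n
  have y: "y \<in> ball x r" using assms by (simp add: dist_commute)
  then have ne: "ball x r \<noteq> {}" by blast
  have "dist ((f ^^ n) y) ((f ^^ n) x) \<le> s n"
    unfolding s_def using y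
    by (intro cSUP_upper bdd_aboveI2[where M = 1]) (auto simp: dist_riemann_sphere_le_1)
  also have "s k \<le> 1" for k
    unfolding s_def using ne by (intro cSUP_least) (simp_all add: dist_riemann_sphere_le_1)
  then have "s n \<le> orbital_modulus f x r"
    unfolding orbital_modulus_def s_def[symmetric]
    by (intro cSUP_upper bdd_aboveI2[where M = 1]) auto
  finally show ?thesis .
qed

lemma orbital_modulus_le:
  assumes "r > 0" "\<And>y n. dist y x < r \<Longrightarrow> dist ((f ^^ n) y) ((f ^^ n) x) \<le> e"
  shows "orbital_modulus f x r \<le> e"
  unfolding orbital_modulus_def using assms
  by (intro cSUP_least) (auto simp: dist_commute)

lemma witnesses_orbital_modulus:
  "witnesses_equi_baire_one_at (orbital_modulus f x) f x"
  unfolding witnesses_equi_baire_one_at_def orbital_delta_def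
  using dist_le_orbital_modulus le_less_trans by blast

lemma orbital_modulus_tendsto_0:
  assumes "orbitally_equi_baire_one_at f x"
  shows "(orbital_modulus f x \<longlongrightarrow> 0) (at_right 0)"
proof (rule tendstoI)
  fix e :: real
  assume "e > 0"
  then obtain d where "d > 0"
    and d: "\<And>y n. dist y x < d \<Longrightarrow> dist ((f ^^ n) y) ((f ^^ n) x) < e / 2"
    using assms unfolding orbitally_equi_baire_one_at_def orbital_delta_def by (meson half_gt_zero)
  have "dist (orbital_modulus f x r) 0 < e" if r: "0 < r" "r < d" for r
  proof -
    have "orbital_modulus f x r \<le> e / 2"
      using d r by (intro orbital_modulus_le) (auto intro: less_imp_le)
    moreover have "0 \<le> orbital_modulus f x r"
      using dist_le_orbital_modulus[of x x r 0 f] r(1) by simp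
    ultimately show ?thesis using \<open>e > 0\<close> by simp
  qed
  then show "\<forall>\<^sub>F r in at_right 0. dist (orbital_modulus f x r) 0 < e"
    using \<open>d > 0\<close> unfolding eventually_at_right_field by blast
qed


section \<open>Loxodromic maps\<close>

theorem theorem1p1:
  fixes A :: "complex^2^2" and p x :: riemann_sphere
  assumes "A \<in> SL2"
    and "loxodromic A"
    and "attracting_fixed_point (moebius_map A) p"
    and "x \<in> attracting_basin (moebius_map A) p"
  shows "orbitally_equi_baire_one_at (moebius_map A) x
    \<and> witnesses_equi_baire_one_at (orbital_modulus (moebius_map A) x) (moebius_map A) x
    \<and> (orbital_modulus (moebius_map A) x \<longlongrightarrow> 0) (at_right 0)"
proof -
  have cont: "continuous_on UNIV (moebius_map A)"
    using assms(1) by (rule continuous_moebius_map)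
  have "orbitally_equi_baire_one_at (moebius_map A) x"
    using stable_at_attracting_fixed_point[OF cont assms(3)] assms(4)
    by (rule orbitally_equi_baire_one_at_basin[OF cont])
  then show ?thesis
    using witnesses_orbital_modulus orbital_modulus_tendsto_0 by blast
qed

end
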